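(* Let $0<q<1$, $\alpha\ge0$ and $m\in\mathbb{N}_0$. Then, for every $x\in[0,1]$, $$S_\infty^{q,\alpha}(e_{m+1};x)=x\sum_{s=0}^{m}\binom{m}{s}q^s(1-q)^{m-s}\,S_\infty^{q,\frac{q\alpha}{1+\alpha}}\left(e_s;\frac{x+\alpha}{1+\alpha}\right).$$
   Context: Write $e_m(t)=t^m$. The $q$-Pochhammer symbols are $(a;q)_0=1$, $(a;q)_m=\prod_{j=0}^{m-1}(1-aq^j)$, $(a;q)_\infty=\prod_{j=0}^\infty(1-aq^j)$. Empty products equal $1$ and $0^0=1$. For $\alpha\ge0$, $k\in\mathbb{N}_0$ and $x\in[0,1]$ let $$p_{\infty k}^{q,\alpha}(x)=\frac{\left(\frac{\gamma}{x+\gamma};q\right)_k\left(\frac{x+\gamma}{1+\gamma};q\right)_\infty\left(\frac{x+\gamma}{1+\gamma}\right)^k}{(q;q)_k\left(\frac{\gamma}{1+\gamma};q\right)_\infty},\qquad \gamma=\frac{\alpha}{1-q},$$ where the product $\left(\frac{\gamma}{x+\gamma};q\right)_k\left(\frac{x+\gamma}{1+\gamma}\right)^k$ is read as $(1+\gamma)^{-k}\prod_{i=0}^{k-1}(x+\gamma-\gamma q^i)$ (relevant only when $x=\gamma=0$). The limit $q$-Stancu operator on $f\in C[0,1]$ is $$S_\infty^{q,\alpha}(f;x)=\sum_{k=0}^\infty f(1-q^k)\,p_{\infty k}^{q,\alpha}(x)\ \text{ for } x\in[0,1),\qquad S_\infty^{q,\alpha}(f;1)=f(1).$$ *)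

theory Defs
  imports "HOL-Analysis.Infinite_Products"
begin

definition q_pochhammer :: "real \<Rightarrow> real \<Rightarrow> nat \<Rightarrow> real" where
  "q_pochhammer a q m = (\<Prod>j<m. 1 - a * q ^ j)"

definition q_pochhammer_inf :: "real \<Rightarrow> real \<Rightarrow> real" where
  "q_pochhammer_inf a q = (\<Prod>j. 1 - a * q ^ j)"

definition monomial_fun :: "nat \<Rightarrow> real \<Rightarrow> real" where
  "monomial_fun m t = t ^ m"

definition stancu_gamma :: "real \<Rightarrow> real \<Rightarrow> real" where
  "stancu_gamma q \<alpha> = \<alpha> / (1 - q)"

text \<open>
  The factor \<open>(\<gamma>/(x+\<gamma>);q)\<^sub>k ((x+\<gamma>)/(1+\<gamma>))\<^sup>k\<close> of the basis function is replaced by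
  \<open>(1+\<gamma>)\<^sup>-\<^sup>k \<Prod>\<^sub>i\<^sub><\<^sub>k (x+\<gamma>-\<gamma>q\<^sup>i)\<close>, which also makes sense for \<open>x = \<gamma> = 0\<close>; the lemma
  \<open>stancu_basis_eq\<close> below recovers the quotient form whenever \<open>x + \<gamma> \<noteq> 0\<close>.
\<close>

definition stancu_basis :: "real \<Rightarrow> real \<Rightarrow> nat \<Rightarrow> real \<Rightarrow> real" where
  "stancu_basis q \<alpha> k x =
     (let \<gamma> = stancu_gamma q \<alpha> in
        ((\<Prod>i<k. x + \<gamma> - \<gamma> * q ^ i) / (1 + \<gamma>) ^ k) * q_pochhammer_inf ((x + \<gamma>) / (1 + \<gamma>)) q /
        (q_pochhammer q q k * q_pochhammer_inf (\<gamma> / (1 + \<gamma>)) q))"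

lemma stancu_basis_eq:
  assumes "\<gamma> = stancu_gamma q \<alpha>" and "x + \<gamma> \<noteq> 0"
  shows "stancu_basis q \<alpha> k x =
     q_pochhammer (\<gamma> / (x + \<gamma>)) q k * q_pochhammer_inf ((x + \<gamma>) / (1 + \<gamma>)) q *
       ((x + \<gamma>) / (1 + \<gamma>)) ^ k /
     (q_pochhammer q q k * q_pochhammer_inf (\<gamma> / (1 + \<gamma>)) q)"
proof -
  have "(\<Prod>i<k. x + \<gamma> - \<gamma> * q ^ i) = (\<Prod>i<k. (1 - \<gamma> / (x + \<gamma>) * q ^ i) * (x + \<gamma>))"
    by (rule prod.cong) (use assms(2) in \<open>auto simp: left_diff_distrib\<close>)
  also have "\<dots> = q_pochhammer (\<gamma> / (x + \<gamma>)) q k * (x + \<gamma>) ^ k"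
    by (simp add: q_pochhammer_def prod.distrib)
  finally show ?thesis
    by (simp add: stancu_basis_def Let_def assms(1)[symmetric] power_divide mult_ac)
qed

definition limit_q_stancu :: "real \<Rightarrow> real \<Rightarrow> (real \<Rightarrow> real) \<Rightarrow> real \<Rightarrow> real" where
  "limit_q_stancu q \<alpha> f x =
     (if x = 1 then f 1 else (\<Sum>k. f (1 - q ^ k) * stancu_basis q \<alpha> k x))"

end

theory Submission
  imports Defs
begin

text \<open>
  Put \<open>\<gamma> = \<alpha>/(1-q)\<close>. The parameter shift \<open>\<alpha> \<mapsto> q\<alpha>/(1+\<alpha>)\<close> and the point shift
  \<open>x \<mapsto> (x+\<alpha>)/(1+\<alpha>)\<close> fit together: they replace \<open>\<gamma>/(1+\<gamma>)\<close> by \<open>q\<gamma>/(1+\<gamma>)\<close> and each factor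
  \<open>(x+\<gamma>-\<gamma>q\<^sup>i)/(1+\<gamma>)\<close> by the next one, \<open>(x+\<gamma>-\<gamma>q\<^bsup>i+1\<^esup>)/(1+\<gamma>)\<close>, while \<open>(x+\<gamma>)/(1+\<gamma>)\<close> is
  unchanged. So, apart from elementary factors, the \<open>k\<close>-th shifted basis function is the
  \<open>(k+1)\<close>-st original one: \<open>(1-q\<^bsup>k+1\<^esup>) p\<^bsub>k+1\<^esub>(x)\<close> equals \<open>x\<close> times the shifted \<open>p\<^sub>k\<close>
  (lemma \<open>stancu_basis_Suc_shift\<close>).

  In the series for \<open>e\<^bsub>m+1\<^esub>\<close> the term \<open>k = 0\<close> vanishes, because its node is \<open>1-q\<^sup>0 = 0\<close>. In every
  other term one of the \<open>m+1\<close> factors \<open>1-q\<^bsup>k+1\<^esup>\<close> is spent on this identity. The other \<open>m\<close>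
  factors are written as \<open>1-q\<^bsup>k+1\<^esup> = q(1-q\<^sup>k) + (1-q)\<close> and expanded by the binomial theorem.
  Interchanging the finite sum with the series is justified by the geometric decay of the basis
  functions for \<open>x < 1\<close> (lemma \<open>summable_abs_stancu_basis\<close>). At \<open>x = 1\<close>, where the operator is
  point evaluation, the identity is \<open>(q + (1-q))\<^sup>m = 1\<close>.
\<close>

lemma q_pochhammer_inf_split_head:
  fixes a q :: real
  assumes "0 < q" "q < 1" "0 \<le> a" "a < 1"
  shows "q_pochhammer_inf a q = (1 - a) * q_pochhammer_inf (a * q) q"
proof -
  have "summable (\<lambda>j. norm (- (a * q ^ j)))"
    using assms by (auto simp: abs_mult intro!: summable_mult summable_geometric)
  then have conv: "convergent_prod (\<lambda>j. 1 + - (a * q ^ j))"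
    by (intro abs_convergent_prod_imp_convergent_prod summable_imp_abs_convergent_prod) simp
  have nz: "1 - a * q ^ j \<noteq> 0" for j
  proof -
    have "a * q ^ j \<le> a * 1"
      using assms by (intro mult_left_mono power_le_one) auto
    then show ?thesis using assms by linarith
  qed
  have "prodinf (\<lambda>j. 1 - a * q ^ j) = (1 - a * q ^ 0) * prodinf (\<lambda>j. 1 - a * q ^ Suc j)"
    using prodinf_split_head[of "\<lambda>j. 1 - a * q ^ j"] conv nz assms by simp
  then show ?thesis
    by (simp add: q_pochhammer_inf_def mult.assoc)
qed

lemma stancu_basis_Suc:
  fixes q \<alpha> x :: real
  shows "stancu_basis q \<alpha> (Suc k) x =
    (x + stancu_gamma q \<alpha> - stancu_gamma q \<alpha> * q ^ k) /
      ((1 + stancu_gamma q \<alpha>) * (1 - q ^ Suc k)) * stancu_basis q \<alpha> k x"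
  by (simp add: stancu_basis_def Let_def q_pochhammer_def mult_ac)

text \<open>
  By the recursion above, consecutive basis functions have quotients tending to
  \<open>(x+\<gamma>)/(1+\<gamma>) < 1\<close>, so the ratio test applies.
\<close>

lemma summable_abs_stancu_basis:
  fixes q \<alpha> x :: real
  assumes "0 < q" "q < 1" "\<alpha> \<ge> 0" "0 \<le> x" "x < 1"
  shows "summable (\<lambda>k. \<bar>stancu_basis q \<alpha> k x\<bar>)"
proof -
  define g where "g = stancu_gamma q \<alpha>"
  have g: "g \<ge> 0" using assms by (simp add: g_def stancu_gamma_def)
  define r where "r k = (x + g - g * q ^ k) / ((1 + g) * (1 - q ^ Suc k))" for k
  have pow: "(\<lambda>k. q ^ k) \<longlonglongrightarrow> 0" using assms by (intro LIMSEQ_power_zero) auto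
  have "(\<lambda>k. \<bar>r k\<bar>) \<longlonglongrightarrow> \<bar>(x + g - g * 0) / ((1 + g) * (1 - 0))\<bar>"
    unfolding r_def using g by (intro tendsto_intros pow LIMSEQ_Suc[OF pow]) auto
  moreover have "(x + g - g * 0) / ((1 + g) * (1 - 0)) = (x + g) / (1 + g)" by simp
  ultimately have lim: "(\<lambda>k. \<bar>r k\<bar>) \<longlonglongrightarrow> (x + g) / (1 + g)"
    using g assms by simp
  have "(x + g) / (1 + g) < 1" using g assms by simp
  then obtain c where c: "(x + g) / (1 + g) < c" "c < 1" using dense by blast
  from order_tendstoD(2)[OF lim c(1)]
  obtain N where N: "\<And>n. n \<ge> N \<Longrightarrow> \<bar>r n\<bar> < c"
    by (auto simp: eventually_sequentially)
  show ?thesis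
  proof (rule summable_ratio_test[OF c(2)])
    fix n assume "N \<le> n"
    have "stancu_basis q \<alpha> (Suc n) x = r n * stancu_basis q \<alpha> n x"
      unfolding r_def g_def by (rule stancu_basis_Suc)
    then show "norm \<bar>stancu_basis q \<alpha> (Suc n) x\<bar> \<le> c * norm \<bar>stancu_basis q \<alpha> n x\<bar>"
      using N[OF \<open>N \<le> n\<close>] by (simp add: abs_mult mult_right_mono)
  qed
qed

lemma summable_bounded_stancu_basis:
  fixes q \<alpha> x :: real
  assumes "0 < q" "q < 1" "\<alpha> \<ge> 0" "0 \<le> x" "x < 1" and bound: "\<And>k. \<bar>w k\<bar> \<le> 1"
  shows "summable (\<lambda>k. w k * stancu_basis q \<alpha> k x)"
proof (rule summable_comparison_test'[OF summable_abs_stancu_basis[OF assms(1-5)]])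
  fix k
  show "norm (w k * stancu_basis q \<alpha> k x) \<le> \<bar>stancu_basis q \<alpha> k x\<bar>"
    using mult_right_mono[OF bound, of "\<bar>stancu_basis q \<alpha> k x\<bar>" k] by (simp add: abs_mult)
qed

lemma monomial_node_le_1:
  fixes q :: real
  assumes "0 < q" "q < 1"
  shows "\<bar>monomial_fun s (1 - q ^ k)\<bar> \<le> 1"
  using assms by (simp add: monomial_fun_def power_abs power_le_one)

text \<open>
  The factor \<open>i = 0\<close> of the numerator of \<open>p\<^bsub>k+1\<^esub>(x)\<close> is \<open>x\<close>, and the remaining \<open>k\<close> factors are those
  of the shifted basis function; \<open>1-q\<^bsup>k+1\<^esup>\<close> is the last factor of \<open>(q;q)\<^bsub>k+1\<^esub>\<close>. The one surplus power
  of \<open>1+\<gamma>\<close> is absorbed by the head factor \<open>1-\<gamma>/(1+\<gamma>) = 1/(1+\<gamma>)\<close> of \<open>(\<gamma>/(1+\<gamma>);q)\<^sub>\<infinity>\<close>.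
\<close>

lemma stancu_basis_Suc_shift:
  fixes q \<alpha> x :: real
  assumes "0 < q" "q < 1" "\<alpha> \<ge> 0"
  shows "(1 - q ^ Suc k) * stancu_basis q \<alpha> (Suc k) x =
    x * stancu_basis q (q * \<alpha> / (1 + \<alpha>)) k ((x + \<alpha>) / (1 + \<alpha>))"
proof -
  define g where "g = stancu_gamma q \<alpha>"
  define g' where "g' = stancu_gamma q (q * \<alpha> / (1 + \<alpha>))"
  define x' where "x' = (x + \<alpha>) / (1 + \<alpha>)"
  have g: "g \<ge> 0" using assms by (simp add: g_def stancu_gamma_def)
  have alpha: "\<alpha> = g * (1 - q)" using assms by (simp add: g_def stancu_gamma_def)
  have a1: "1 + \<alpha> > 0" using assms by simp
  have g': "g' = q * g / (1 + \<alpha>)" by (simp add: g'_def g_def stancu_gamma_def mult_ac)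
  have one_g': "1 + g' = (1 + g) / (1 + \<alpha>)"
    unfolding g' using a1 alpha by (simp add: field_simps)
  have x'g': "x' + g' = (x + g) / (1 + \<alpha>)"
    unfolding g' x'_def using a1 alpha
    by (simp add: add_divide_distrib[symmetric] algebra_simps)
  have quot_g: "g' / (1 + g') = g / (1 + g) * q"
    unfolding one_g' using a1 by (simp add: g')
  have quot_x: "(x' + g') / (1 + g') = (x + g) / (1 + g)"
    unfolding one_g' x'g' using a1 by simp
  have "x' + g' - g' * q ^ i = (x + g - g * q ^ Suc i) / (1 + \<alpha>)" for i
    unfolding x'g' unfolding g' by (simp add: diff_divide_distrib mult_ac)
  then have "(\<Prod>i<k. x' + g' - g' * q ^ i) = (\<Prod>i<k. x + g - g * q ^ Suc i) / (1 + \<alpha>) ^ k"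
    by (simp add: prod_dividef)
  then have num: "(\<Prod>i<k. x' + g' - g' * q ^ i) / (1 + g') ^ k =
      (\<Prod>i<k. x + g - g * q ^ Suc i) / (1 + g) ^ k"
    unfolding one_g' using a1 by (simp add: power_divide)
  have inf: "q_pochhammer_inf (g / (1 + g)) q =
      q_pochhammer_inf (g / (1 + g) * q) q / (1 + g)"
  proof -
    have "1 - g / (1 + g) = 1 / (1 + g)" using g by (simp add: field_simps)
    then show ?thesis
      using q_pochhammer_inf_split_head[of q "g / (1 + g)"] assms g by simp
  qed
  have "q ^ Suc k < 1" using assms by (intro power_Suc_less_one) auto
  then have nz: "1 - q ^ Suc k \<noteq> 0" by simp
  have poch: "q_pochhammer q q (Suc k) = q_pochhammer q q k * (1 - q ^ Suc k)"
    by (simp add: q_pochhammer_def)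
  have head: "(\<Prod>i<Suc k. x + g - g * q ^ i) = x * (\<Prod>i<k. x + g - g * q ^ Suc i)"
    by (subst prod.lessThan_Suc_shift) simp
  have "(1 - q ^ Suc k) * stancu_basis q \<alpha> (Suc k) x =
      x * ((\<Prod>i<k. x + g - g * q ^ Suc i) / (1 + g) ^ k * q_pochhammer_inf ((x + g) / (1 + g)) q /
        (q_pochhammer q q k * q_pochhammer_inf (g / (1 + g) * q) q))"
    unfolding stancu_basis_def Let_def g_def[symmetric] head poch inf
    using nz g by (simp add: divide_simps del: power_Suc) (simp add: mult_ac)
  also have "\<dots> = x * stancu_basis q (q * \<alpha> / (1 + \<alpha>)) k x'"
    unfolding stancu_basis_def Let_def g'_def[symmetric] num quot_x quot_g ..
  finally show ?thesis unfolding x'_def .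
qed

theorem corollary3p11:
  fixes q \<alpha> x :: real and m :: nat
  assumes "0 < q" and "q < 1" and "\<alpha> \<ge> 0" and "x \<in> {0..1}"
  shows "limit_q_stancu q \<alpha> (monomial_fun (m + 1)) x =
    x * (\<Sum>s=0..m. real (m choose s) * q ^ s * (1 - q) ^ (m - s) *
          limit_q_stancu q (q * \<alpha> / (1 + \<alpha>)) (monomial_fun s) ((x + \<alpha>) / (1 + \<alpha>)))"
proof (cases "x = 1")
  case True
  have "(x + \<alpha>) / (1 + \<alpha>) = 1" using True assms by simp
  moreover have "(\<Sum>s=0..m. real (m choose s) * q ^ s * (1 - q) ^ (m - s)) = (q + (1 - q)) ^ m"
    by (simp only: binomial_ring atMost_atLeast0)
  ultimately show ?thesis
    using True by (simp add: limit_q_stancu_def monomial_fun_def)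
next
  case False
  then have x: "0 \<le> x" "x < 1" using assms by auto
  define a' where "a' = q * \<alpha> / (1 + \<alpha>)"
  define x' where "x' = (x + \<alpha>) / (1 + \<alpha>)"
  have a': "a' \<ge> 0" using assms by (simp add: a'_def)
  have x': "0 \<le> x'" "x' < 1" using x assms by (auto simp: x'_def)
  define P where "P k = stancu_basis q a' k x'" for k
  define c where "c s = real (m choose s) * q ^ s * (1 - q) ^ (m - s)" for s
  have summand: "(1 - q ^ Suc k) ^ (m + 1) * stancu_basis q \<alpha> (Suc k) x =
      x * (\<Sum>s=0..m. c s * (monomial_fun s (1 - q ^ k) * P k))" for k
  proof -
    have "1 - q ^ Suc k = q * (1 - q ^ k) + (1 - q)" by (simp add: algebra_simps)
    then have expand: "(1 - q ^ Suc k) ^ m = (\<Sum>s=0..m. c s * monomial_fun s (1 - q ^ k))"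
      by (simp only: binomial_ring atMost_atLeast0 c_def monomial_fun_def power_mult_distrib mult_ac)
    have "(1 - q ^ Suc k) ^ (m + 1) * stancu_basis q \<alpha> (Suc k) x =
        (1 - q ^ Suc k) ^ m * ((1 - q ^ Suc k) * stancu_basis q \<alpha> (Suc k) x)"
      by (simp del: power_Suc add: power_Suc[of _ m] mult_ac)
    also have "\<dots> = x * ((1 - q ^ Suc k) ^ m * P k)"
      unfolding stancu_basis_Suc_shift[OF assms(1-3)] P_def a'_def x'_def by (simp only: mult_ac)
    finally show ?thesis
      unfolding expand by (simp add: sum_distrib_right mult.assoc)
  qed
  have summ: "summable (\<lambda>k. monomial_fun s (1 - q ^ k) * P k)" for s
    unfolding P_def
    by (rule summable_bounded_stancu_basis[OF assms(1,2) a' x' monomial_node_le_1[OF assms(1,2)]])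
  have summ0: "summable (\<lambda>k. monomial_fun (m + 1) (1 - q ^ k) * stancu_basis q \<alpha> k x)"
    by (rule summable_bounded_stancu_basis[OF assms(1-3) x monomial_node_le_1[OF assms(1,2)]])
  have "limit_q_stancu q \<alpha> (monomial_fun (m + 1)) x =
      (\<Sum>k. monomial_fun (m + 1) (1 - q ^ k) * stancu_basis q \<alpha> k x)"
    using False by (simp add: limit_q_stancu_def)
  also have "\<dots> = (\<Sum>k. monomial_fun (m + 1) (1 - q ^ Suc k) * stancu_basis q \<alpha> (Suc k) x)"
    using suminf_split_head[OF summ0] by (simp add: monomial_fun_def)
  also have "\<dots> = (\<Sum>k. x * (\<Sum>s=0..m. c s * (monomial_fun s (1 - q ^ k) * P k)))"
    unfolding monomial_fun_def[of "m + 1"] summand ..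
  also have "\<dots> = x * (\<Sum>k. \<Sum>s=0..m. c s * (monomial_fun s (1 - q ^ k) * P k))"
    by (intro suminf_mult summable_sum summable_mult summ)
  also have "\<dots> = x * (\<Sum>s=0..m. c s * (\<Sum>k. monomial_fun s (1 - q ^ k) * P k))"
    by (subst suminf_sum) (auto intro: summ summable_mult simp: suminf_mult[OF summ])
  also have "\<dots> = x * (\<Sum>s=0..m. c s * limit_q_stancu q a' (monomial_fun s) x')"
    using x' by (simp add: limit_q_stancu_def P_def)
  finally show ?thesis unfolding c_def a'_def x'_def .
qed

end
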